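(* Let $(X,d,\preccurlyeq)$ be a sequentially increasingly right $K$-complete preordered quasi-metric space. Suppose that for every sequence $(x_n)_{n\in\mathbb{N}}$ in $X$ and every $x\in X$: if $x_n\preccurlyeq x_{n+1}$ for all $n\in\mathbb{N}$ and $x_n\xrightarrow{d}x$, then $x_n\preccurlyeq x$ for all $n\in\mathbb{N}$. Let $\varphi:X\to\mathbb{R}\cup\{\infty\}$ be a proper, bounded below and increasingly lsc function. Let $\varepsilon,\lambda>0$ and let $x_0\in X$ be such that $$\varphi(x_0)\le\varepsilon+\inf\varphi(X).$$ For $x\in X$ put $S(x)=\{y\in X: x\preccurlyeq y\text{ and }\varphi(y)+\frac{\varepsilon}{\lambda}d(y,x)\le\varphi(x)\}$. Then there exists $z\in\operatorname{dom}\varphi$ such that (i) $\varphi(z)+\frac{\varepsilon}{\lambda}d(z,x_0)\le\varphi(x_0)$ (and so $\varphi(z)\le\varphi(x_0)$); (ii) $d(z,x_0)\le\lambda$; (iii) $\varphi(y)=\varphi(z)$ for all $y\in S(z)$; (iv) $\varphi(z)<\varphi(x)+\frac{\varepsilon}{\lambda}d(x,z)$ for all $x\in\operatorname{dom}\varphi\setminus S(z)$ with $z\preccurlyeq x$, and for all $x\in X\setminus\operatorname{dom}\varphi$.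
   Context: A quasi-metric on a set $X$ is a map $d:X\times X\to[0,\infty)$ with $d(x,x)=0$, $d(x,z)\le d(x,y)+d(y,z)$, and $d(x,y)=d(y,x)=0\Rightarrow x=y$ (symmetry is not required). The topology $\tau_d$ is generated by the balls $B_d(x,r)=\{y: d(x,y)<r\}$; all topological notions refer to $\tau_d$. Thus $x_n\xrightarrow{d}x$ means $d(x,x_n)\to0$. A preordered quasi-metric space $(X,d,\preccurlyeq)$ is a quasi-metric space with a reflexive and transitive relation $\preccurlyeq$. A sequence is increasing if $x_n\preccurlyeq x_{n+1}$ for all $n$. A sequence is right $K$-Cauchy if for every $\varepsilon>0$ there is $n_\varepsilon$ such that $d(x_m,x_n)<\varepsilon$ whenever $n_\varepsilon\le n<m$. The space is sequentially increasingly right $K$-complete if every increasing right $K$-Cauchy sequence is convergent (with respect to $\tau_d$). For $\varphi:X\to\mathbb{R}\cup\{\infty\}$, $\operatorname{dom}\varphi=\{x:\varphi(x)<\infty\}$; $\varphi$ is proper if $\operatorname{dom}\varphi\ne\emptyset$; $\varphi$ is increasingly lsc if $\varphi(x)\le\liminf_n\varphi(x_n)$ for every increasing sequence $(x_n)$ with $x_n\xrightarrow{d}x$. *)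

theory Defs
  imports "HOL-Analysis.Analysis"
begin

locale quasi_metric_space =
  fixes X :: "'a set" and d :: "'a \<Rightarrow> 'a \<Rightarrow> real"
  assumes nonneg: "\<lbrakk>x \<in> X; y \<in> X\<rbrakk> \<Longrightarrow> 0 \<le> d x y"
    and refl_zero: "x \<in> X \<Longrightarrow> d x x = 0"
    and triangle: "\<lbrakk>x \<in> X; y \<in> X; z \<in> X\<rbrakk> \<Longrightarrow> d x z \<le> d x y + d y z"
    and separated: "\<lbrakk>x \<in> X; y \<in> X; d x y = 0; d y x = 0\<rbrakk> \<Longrightarrow> x = y"

locale preordered_quasi_metric_space = quasi_metric_space X d
  for X :: "'a set" and d :: "'a \<Rightarrow> 'a \<Rightarrow> real" +
  fixes le :: "'a \<Rightarrow> 'a \<Rightarrow> bool"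
  assumes le_refl: "reflp_on X le"
    and le_trans: "transp_on X le"

definition qm_ball :: "'a set \<Rightarrow> ('a \<Rightarrow> 'a \<Rightarrow> real) \<Rightarrow> 'a \<Rightarrow> real \<Rightarrow> 'a set" where
  "qm_ball X d x r = {y \<in> X. d x y < r}"

definition qm_topology :: "'a set \<Rightarrow> ('a \<Rightarrow> 'a \<Rightarrow> real) \<Rightarrow> 'a topology" where
  "qm_topology X d = topology_generated_by {qm_ball X d x r | x r. x \<in> X \<and> 0 < r}"

definition qm_converges :: "'a set \<Rightarrow> ('a \<Rightarrow> 'a \<Rightarrow> real) \<Rightarrow> (nat \<Rightarrow> 'a) \<Rightarrow> 'a \<Rightarrow> bool" where
  "qm_converges X d s x \<longleftrightarrow> limitin (qm_topology X d) s x sequentially"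

definition increasing_seq :: "('a \<Rightarrow> 'a \<Rightarrow> bool) \<Rightarrow> (nat \<Rightarrow> 'a) \<Rightarrow> bool" where
  "increasing_seq le s \<longleftrightarrow> (\<forall>n. le (s n) (s (Suc n)))"

definition right_K_Cauchy :: "('a \<Rightarrow> 'a \<Rightarrow> real) \<Rightarrow> (nat \<Rightarrow> 'a) \<Rightarrow> bool" where
  "right_K_Cauchy d s \<longleftrightarrow>
     (\<forall>e>0. \<exists>N. \<forall>n m. N \<le> n \<and> n < m \<longrightarrow> d (s m) (s n) < e)"

definition seq_increasingly_right_K_complete ::
  "'a set \<Rightarrow> ('a \<Rightarrow> 'a \<Rightarrow> real) \<Rightarrow> ('a \<Rightarrow> 'a \<Rightarrow> bool) \<Rightarrow> bool" where
  "seq_increasingly_right_K_complete X d le \<longleftrightarrow>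
     (\<forall>s. range s \<subseteq> X \<and> increasing_seq le s \<and> right_K_Cauchy d s
        \<longrightarrow> (\<exists>x\<in>X. qm_converges X d s x))"

text \<open>Functions into \<open>\<real> \<union> {\<infinity>}\<close> are modelled as \<open>ereal\<close>-valued functions; that they omit
  the value \<open>-\<infinity>\<close> on \<open>X\<close> has to be stated separately.\<close>

definition eff_dom :: "'a set \<Rightarrow> ('a \<Rightarrow> ereal) \<Rightarrow> 'a set" where
  "eff_dom X \<phi> = {x \<in> X. \<phi> x < \<infinity>}"

definition proper_fun :: "'a set \<Rightarrow> ('a \<Rightarrow> ereal) \<Rightarrow> bool" where
  "proper_fun X \<phi> \<longleftrightarrow> eff_dom X \<phi> \<noteq> {}"

definition bounded_below_fun :: "'a set \<Rightarrow> ('a \<Rightarrow> ereal) \<Rightarrow> bool" where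
  "bounded_below_fun X \<phi> \<longleftrightarrow> (\<exists>c::real. \<forall>x\<in>X. ereal c \<le> \<phi> x)"

definition increasingly_lsc ::
  "'a set \<Rightarrow> ('a \<Rightarrow> 'a \<Rightarrow> real) \<Rightarrow> ('a \<Rightarrow> 'a \<Rightarrow> bool) \<Rightarrow> ('a \<Rightarrow> ereal) \<Rightarrow> bool" where
  "increasingly_lsc X d le \<phi> \<longleftrightarrow>
     (\<forall>s. \<forall>x\<in>X. range s \<subseteq> X \<and> increasing_seq le s \<and> qm_converges X d s x
        \<longrightarrow> \<phi> x \<le> liminf (\<lambda>n. \<phi> (s n)))"

definition S_set ::
  "'a set \<Rightarrow> ('a \<Rightarrow> 'a \<Rightarrow> real) \<Rightarrow> ('a \<Rightarrow> 'a \<Rightarrow> bool) \<Rightarrow> ('a \<Rightarrow> ereal) \<Rightarrow> real \<Rightarrow> real \<Rightarrow> 'a \<Rightarrow> 'a set" where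
  "S_set X d le \<phi> \<epsilon> lam x = {y \<in> X. le x y \<and> \<phi> y + ereal (\<epsilon> / lam * d y x) \<le> \<phi> x}"

context quasi_metric_space
begin

lemma topspace_qm_topology: "topspace (qm_topology X d) = X"
proof -
  have "\<exists>r. x \<in> qm_ball X d x r \<and> 0 < r" if "x \<in> X" for x
    using that by (intro exI[of _ 1]) (simp add: qm_ball_def refl_zero)
  then show ?thesis
    unfolding qm_topology_def topology_generated_by_topspace
    by (auto simp: qm_ball_def) blast
qed

lemma openin_qm_ball: "\<lbrakk>x \<in> X; 0 < r\<rbrakk> \<Longrightarrow> openin (qm_topology X d) (qm_ball X d x r)"
  unfolding qm_topology_def by (rule topology_generated_by_Basis) blast

lemma openin_qm_topology_ball:
  assumes "openin (qm_topology X d) U" "x \<in> U"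
  shows "\<exists>r>0. qm_ball X d x r \<subseteq> U"
proof -
  have "generate_topology_on {qm_ball X d x r | x r. x \<in> X \<and> 0 < r} U"
    using assms(1) by (simp add: qm_topology_def openin_topology_generated_by_iff)
  then show ?thesis
    using assms(2)
  proof (induction arbitrary: x)
    case Empty
    then show ?case by simp
  next
    case (Int a b)
    then obtain r1 r2 where "r1 > 0" "qm_ball X d x r1 \<subseteq> a" "r2 > 0" "qm_ball X d x r2 \<subseteq> b"
      by blast
    then show ?case
      by (intro exI[of _ "min r1 r2"]) (auto simp: qm_ball_def)
  next
    case (UN K)
    then show ?case by (meson Union_iff Union_upper subset_trans)
  next
    case (Basis s)
    then obtain y r where y: "s = qm_ball X d y r" "y \<in> X" "0 < r" by blast
    with Basis have x: "x \<in> X" "d y x < r" by (auto simp: qm_ball_def)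
    have "qm_ball X d x (r - d y x) \<subseteq> s"
      using triangle[OF y(2) x(1)] unfolding y(1) qm_ball_def by force
    with x show ?case by (intro exI[of _ "r - d y x"]) auto
  qed
qed

lemma qm_converges_iff:
  assumes "range s \<subseteq> X" "x \<in> X"
  shows "qm_converges X d s x \<longleftrightarrow> (\<lambda>n. d x (s n)) \<longlonglongrightarrow> 0"
proof
  assume L: "qm_converges X d s x"
  have "eventually (\<lambda>n. dist (d x (s n)) 0 < e) sequentially" if "e > 0" for e
  proof -
    have "x \<in> qm_ball X d x e"
      using assms that by (simp add: qm_ball_def refl_zero)
    then have "eventually (\<lambda>n. s n \<in> qm_ball X d x e) sequentially"
      using L openin_qm_ball[OF assms(2) that] by (simp add: qm_converges_def limitin_def)
    then show ?thesis
      by eventually_elim (use assms nonneg in \<open>auto simp: qm_ball_def\<close>)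
  qed
  then show "(\<lambda>n. d x (s n)) \<longlonglongrightarrow> 0" by (rule tendstoI)
next
  assume L: "(\<lambda>n. d x (s n)) \<longlonglongrightarrow> 0"
  have "eventually (\<lambda>n. s n \<in> U) sequentially" if U: "openin (qm_topology X d) U" "x \<in> U" for U
  proof -
    obtain r where r: "r > 0" "qm_ball X d x r \<subseteq> U"
      using openin_qm_topology_ball[OF U] by blast
    have "eventually (\<lambda>n. d x (s n) < r) sequentially"
      using L r(1) by (rule order_tendstoD(2))
    then show ?thesis
      by eventually_elim (use assms r(2) in \<open>auto simp: qm_ball_def\<close>)
  qed
  then show "qm_converges X d s x"
    using assms(2) by (simp add: qm_converges_def limitin_def topspace_qm_topology)
qed

end

end

theory Submission
  imports Defs
begin

text \<open>
  The sets \<open>S(x)\<close> are the upper sets of a preorder. Starting from \<open>x\<^sub>0\<close>, choose \<open>x\<^sub>n\<^sub>+\<^sub>1 \<in> S(x\<^sub>n)\<close>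
  with \<open>\<phi>(x\<^sub>n\<^sub>+\<^sub>1) \<le> \<phi>(w) + 1/(n+1)\<close> for all \<open>w \<in> S(x\<^sub>n)\<close>. Since \<open>(\<epsilon>/\<lambda>) d(x\<^sub>m, x\<^sub>n)\<close> is at most
  \<open>\<phi>(x\<^sub>n) - \<phi>(x\<^sub>m)\<close> for \<open>n < m\<close> and \<open>\<phi>(x\<^sub>n)\<close> decreases to a limit \<open>L\<close>, the sequence is right \<open>K\<close>-Cauchy;
  by lower semicontinuity its limit \<open>z\<close> lies in every \<open>S(x\<^sub>n)\<close> and has \<open>\<phi>(z) \<le> L\<close>. Any \<open>y \<in> S(z)\<close>
  lies in every \<open>S(x\<^sub>n)\<close> too, so the near-minimality of \<open>x\<^sub>n\<^sub>+\<^sub>1\<close> yields \<open>\<phi>(y) \<ge> L \<ge> \<phi>(z)\<close>.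
\<close>

lemma ex_approximate_minimizer:
  fixes f :: "'a \<Rightarrow> real"
  assumes "A \<noteq> {}" "bdd_below (f ` A)" "\<delta> > 0"
  shows "\<exists>y\<in>A. \<forall>w\<in>A. f y \<le> f w + \<delta>"
proof -
  have "Inf (f ` A) < Inf (f ` A) + \<delta>" using assms(3) by simp
  then obtain y where y: "y \<in> A" "f y < Inf (f ` A) + \<delta>"
    using cInf_lessD[of "f ` A"] assms(1) by blast
  moreover have "Inf (f ` A) \<le> f w" if "w \<in> A" for w
    using that assms(2) by (simp add: cInf_lower)
  ultimately show ?thesis by (intro bexI[of _ y]) force+
qed

lemma eff_domD:
  assumes "x \<in> eff_dom X \<phi>" "\<forall>x\<in>X. \<phi> x \<noteq> -\<infinity>"
  shows "x \<in> X" "\<phi> x = ereal (real_of_ereal (\<phi> x))"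
proof -
  show "x \<in> X" using assms(1) by (simp add: eff_dom_def)
  then show "\<phi> x = ereal (real_of_ereal (\<phi> x))"
    using assms by (cases "\<phi> x") (auto simp: eff_dom_def)
qed

text \<open>For \<open>x\<close> in the effective domain the inequality in \<open>S_set\<close>
  excludes the value \<infinity> at \<open>y\<close>, and \<open>ninf\<close> excludes -\<infinity>.
  Hence all later estimates can be done in real arithmetic.\<close>

lemma S_set_iff_real:
  assumes x: "x \<in> eff_dom X \<phi>" and ninf: "\<forall>x\<in>X. \<phi> x \<noteq> -\<infinity>"
  shows "y \<in> S_set X d le \<phi> \<epsilon> lam x \<longleftrightarrow>
    y \<in> eff_dom X \<phi> \<and> le x y \<and>
    real_of_ereal (\<phi> y) + \<epsilon> / lam * d y x \<le> real_of_ereal (\<phi> x)"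
proof (cases "y \<in> X")
  case True
  show ?thesis
  proof (cases "\<phi> y")
    case (real r)
    then show ?thesis
      using True by (subst S_set_def, simp, subst eff_domD(2)[OF x ninf]) (simp add: eff_dom_def)
  next
    case PInf
    then show ?thesis
      by (subst S_set_def, simp, subst eff_domD(2)[OF x ninf]) (simp add: eff_dom_def)
  next
    case MInf
    then show ?thesis using ninf True by blast
  qed
qed (simp add: S_set_def eff_dom_def)

context preordered_quasi_metric_space
begin

lemma S_set_refl:
  assumes "x \<in> X"
  shows "x \<in> S_set X d le \<phi> \<epsilon> lam x"
  using assms le_refl by (simp add: S_set_def refl_zero reflp_on_def flip: zero_ereal_def)

text \<open>The two inequalities add up, and the triangle inequality along \<open>w\<close>,
  \<open>y\<close>, \<open>x\<close>, scaled by the nonnegative factor, merges the two distance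
  terms.\<close>

lemma S_set_trans:
  assumes ninf: "\<forall>x\<in>X. \<phi> x \<noteq> -\<infinity>" and x: "x \<in> eff_dom X \<phi>" and pos: "\<epsilon> / lam \<ge> 0"
    and y: "y \<in> S_set X d le \<phi> \<epsilon> lam x" and w: "w \<in> S_set X d le \<phi> \<epsilon> lam y"
  shows "w \<in> S_set X d le \<phi> \<epsilon> lam x"
proof -
  note y' = y[unfolded S_set_iff_real[OF x ninf]]
  have yD: "y \<in> eff_dom X \<phi>" using y' by blast
  note w' = w[unfolded S_set_iff_real[OF yD ninf]]
  have X: "x \<in> X" "y \<in> X" "w \<in> X" using x yD w' by (auto simp: eff_dom_def)
  have "\<epsilon> / lam * d w x \<le> \<epsilon> / lam * (d w y + d y x)"
    using triangle[of w y x] X pos by (intro mult_left_mono) auto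
  moreover have "le x w" using le_trans X y' w' unfolding transp_on_def by blast
  ultimately show ?thesis
    unfolding S_set_iff_real[OF x ninf] using y' w' unfolding distrib_left by linarith
qed

text \<open>Membership of \<open>z\<close> in the set of \<open>x0\<close> is claim (i) of the
  theorem, and constancy of \<open>\<phi>\<close> on the set of \<open>z\<close> is claim
  (iii).\<close>

lemma ex_minimal_in_S_set:
  fixes \<phi> :: "'a \<Rightarrow> ereal" and \<epsilon> lam :: real
  assumes complete: "seq_increasingly_right_K_complete X d le"
    and closed: "\<And>s x. \<lbrakk>range s \<subseteq> X; x \<in> X; \<forall>n. le (s n) (s (Suc n)); qm_converges X d s x\<rbrakk>
           \<Longrightarrow> \<forall>n. le (s n) x"
    and ninf: "\<forall>x\<in>X. \<phi> x \<noteq> -\<infinity>"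
    and bdd: "bounded_below_fun X \<phi>"
    and lsc: "increasingly_lsc X d le \<phi>"
    and pos: "\<epsilon> / lam > 0"
    and x0: "x0 \<in> eff_dom X \<phi>"
  shows "\<exists>z\<in>S_set X d le \<phi> \<epsilon> lam x0. \<forall>y\<in>S_set X d le \<phi> \<epsilon> lam z. \<phi> y = \<phi> z"
proof -
  define \<gamma> where "\<gamma> = \<epsilon> / lam"
  define f where "f x = real_of_ereal (\<phi> x)" for x
  let ?D = "eff_dom X \<phi>" and ?S = "S_set X d le \<phi> \<epsilon> lam"
  have \<gamma>: "\<gamma> > 0" using pos by (simp add: \<gamma>_def)
  have DX: "x \<in> X" if "x \<in> ?D" for x using that by (simp add: eff_dom_def)
  have \<phi>_f: "\<phi> x = ereal (f x)" if "x \<in> ?D" for x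
    using eff_domD(2)[OF that ninf] by (simp add: f_def)
  have S_iff: "y \<in> ?S x \<longleftrightarrow> y \<in> ?D \<and> le x y \<and> f y + \<gamma> * d y x \<le> f x" if "x \<in> ?D" for x y
    using S_set_iff_real[OF that ninf] by (simp add: f_def \<gamma>_def)
  obtain c where c: "\<forall>x\<in>X. ereal c \<le> \<phi> x" using bdd by (auto simp: bounded_below_fun_def)
  have c_le: "c \<le> f x" if "x \<in> ?D" for x using c DX[OF that] \<phi>_f[OF that] by force
  \<comment> \<open>The clause for \<open>n = 0\<close> in the invariant pins the start of the
    dependent choice to \<open>x0\<close>.\<close>
  have "\<exists>s. \<forall>n. (s n \<in> ?D \<and> (n = 0 \<longrightarrow> s n = x0)) \<and>
      (s (Suc n) \<in> ?S (s n) \<and> (\<forall>w\<in>?S (s n). f (s (Suc n)) \<le> f w + inverse (real (Suc n))))"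
  proof (rule dependent_nat_choice)
    fix x and n :: nat assume "x \<in> ?D \<and> (n = 0 \<longrightarrow> x = x0)"
    then have x: "x \<in> ?D" by blast
    have "bdd_below (f ` ?S x)" using c_le S_iff[OF x] by (auto intro!: bdd_belowI2[of _ c])
    then have "\<exists>y\<in>?S x. \<forall>w\<in>?S x. f y \<le> f w + inverse (real (Suc n))"
      using S_set_refl[OF DX[OF x]] by (intro ex_approximate_minimizer) auto
    then show "\<exists>y. (y \<in> ?D \<and> (Suc n = 0 \<longrightarrow> y = x0)) \<and>
        (y \<in> ?S x \<and> (\<forall>w\<in>?S x. f y \<le> f w + inverse (real (Suc n))))"
      using S_iff[OF x] by blast
  qed (use x0 in auto)
  then obtain s where sD: "\<And>n. s n \<in> ?D" and s0: "s 0 = x0"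
    and s_step: "\<And>n. s (Suc n) \<in> ?S (s n)"
    and s_min: "\<And>n w. w \<in> ?S (s n) \<Longrightarrow> f (s (Suc n)) \<le> f w + inverse (real (Suc n))"
    by blast
  have sX: "range s \<subseteq> X" using sD DX by blast
  have s_S: "s m \<in> ?S (s n)" if "n \<le> m" for n m
    using that
  proof (induction m rule: dec_induct)
    case base
    then show ?case by (rule S_set_refl[OF DX[OF sD]])
  next
    case (step m)
    then show ?case using S_set_trans[OF ninf sD less_imp_le[OF pos]] s_step by blast
  qed
  have s_d: "f (s m) + \<gamma> * d (s m) (s n) \<le> f (s n)" if "n \<le> m" for n m
    using s_S[OF that] S_iff[OF sD] by blast
  have inc: "increasing_seq le s"
    using s_step S_iff[OF sD] by (auto simp: increasing_seq_def)
  have "decseq (\<lambda>n. f (s n))"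
  proof (rule decseq_SucI)
    fix n
    have "0 \<le> \<gamma> * d (s (Suc n)) (s n)" using \<gamma> nonneg[OF DX[OF sD] DX[OF sD]] by simp
    then show "f (s (Suc n)) \<le> f (s n)" using s_d[of n "Suc n"] by simp
  qed
  then obtain L where L: "(\<lambda>n. f (s n)) \<longlonglongrightarrow> L" and L_le: "\<And>n. L \<le> f (s n)"
    using c_le[OF sD] decseq_convergent[of "\<lambda>n. f (s n)" c] by blast
  have "right_K_Cauchy d s"
    unfolding right_K_Cauchy_def
  proof (intro allI impI)
    fix e :: real assume e: "e > 0"
    \<comment> \<open>The margin is \<open>\<gamma> * e\<close> because \<open>s_d\<close> bounds
      \<open>\<gamma> * d (s m) (s n)\<close> by \<open>f (s n) - f (s m)\<close>, where
      \<open>f (s m)\<close> is at least \<open>L\<close>.\<close>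
    have "eventually (\<lambda>n. f (s n) < L + \<gamma> * e) sequentially"
      using L e \<gamma> by (intro order_tendstoD(2)) auto
    then obtain N where N: "\<And>n. n \<ge> N \<Longrightarrow> f (s n) < L + \<gamma> * e"
      by (auto simp: eventually_sequentially)
    have "d (s m) (s n) < e" if "N \<le> n" "n < m" for n m
    proof -
      have "\<gamma> * d (s m) (s n) < \<gamma> * e"
        using s_d[of n m] N[of n] L_le[of m] that by linarith
      then show ?thesis using \<gamma> by simp
    qed
    then show "\<exists>N. \<forall>n m. N \<le> n \<and> n < m \<longrightarrow> d (s m) (s n) < e" by blast
  qed
  then obtain z where zX: "z \<in> X" and z: "qm_converges X d s z"
    using complete sX inc unfolding seq_increasingly_right_K_complete_def by blast
  have dz: "(\<lambda>n. d z (s n)) \<longlonglongrightarrow> 0" using qm_converges_iff[OF sX zX] z by blast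
  have le_z: "le (s n) z" for n
    using closed[OF sX zX _ z] inc by (simp add: increasing_seq_def)
  have "\<phi> z \<le> liminf (\<lambda>n. \<phi> (s n))"
    using lsc zX sX inc z unfolding increasingly_lsc_def by blast
  also have "\<dots> = ereal L"
    using L by (intro lim_imp_Liminf) (auto simp: \<phi>_f[OF sD])
  finally have \<phi>z: "\<phi> z \<le> ereal L" .
  \<comment> \<open>The bound from lower semicontinuity also shows that \<open>\<phi> z\<close> is
    finite.\<close>
  then have zD: "z \<in> ?D" using zX by (auto simp: eff_dom_def)
  have fz: "f z \<le> L" using \<phi>z \<phi>_f[OF zD] by simp
  have z_S: "z \<in> ?S (s n)" for n
  proof -
    \<comment> \<open>Going from \<open>z\<close> to \<open>s n\<close> through \<open>s m\<close>
      costs the extra term \<open>d z (s m)\<close>, which is exactly the distance that convergence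
      to \<open>z\<close> sends to 0 as \<open>m\<close> grows.\<close>
    have "f (s m) + \<gamma> * d z (s n) \<le> f (s n) + \<gamma> * d z (s m)" if "n \<le> m" for m
    proof -
      have "\<gamma> * d z (s n) \<le> \<gamma> * (d z (s m) + d (s m) (s n))"
        using \<gamma> triangle[of z "s m" "s n"] zX sX by (intro mult_left_mono) auto
      then show ?thesis using s_d[OF that] unfolding distrib_left by linarith
    qed
    moreover have "(\<lambda>m. f (s m) + \<gamma> * d z (s n)) \<longlonglongrightarrow> L + \<gamma> * d z (s n)"
      by (intro tendsto_intros L)
    moreover have "(\<lambda>m. f (s n) + \<gamma> * d z (s m)) \<longlonglongrightarrow> f (s n) + \<gamma> * 0"
      by (intro tendsto_intros dz)
    ultimately have "L + \<gamma> * d z (s n) \<le> f (s n) + \<gamma> * 0"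
      by (intro LIMSEQ_le) auto
    then show ?thesis using S_iff[OF sD] zD le_z fz by simp
  qed
  have "\<phi> y = \<phi> z" if y: "y \<in> ?S z" for y
  proof -
    have yD: "y \<in> ?D" and yz: "f y + \<gamma> * d y z \<le> f z" using y S_iff[OF zD] by auto
    \<comment> \<open>By transitivity through \<open>z\<close>, the point \<open>y\<close> competes
      in the choice of every \<open>s (Suc n)\<close>. In the limit this closes the chain
      \<open>L \<le> f y \<le> f z \<le> L\<close>.\<close>
    have "f (s (Suc n)) \<le> f y + inverse (real (Suc n))" for n
      using S_set_trans[OF ninf sD less_imp_le[OF pos] z_S y] by (rule s_min)
    moreover have "(\<lambda>n. f y + inverse (real (Suc n))) \<longlonglongrightarrow> f y + 0"
      by (intro tendsto_intros LIMSEQ_inverse_real_of_nat)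
    ultimately have "L \<le> f y"
      using LIMSEQ_le[OF LIMSEQ_Suc[OF L], of "\<lambda>n. f y + inverse (real (Suc n))" "f y"] by simp
    moreover have "0 \<le> \<gamma> * d y z" using \<gamma> nonneg[OF DX[OF yD] zX] by simp
    ultimately show ?thesis using fz yz \<phi>_f yD zD by simp
  qed
  then show ?thesis using z_S[of 0] s0 by auto
qed

end

theorem theorem3p4:
  fixes X :: "'a set" and d :: "'a \<Rightarrow> 'a \<Rightarrow> real" and le :: "'a \<Rightarrow> 'a \<Rightarrow> bool"
    and \<phi> :: "'a \<Rightarrow> ereal" and \<epsilon> lam :: real and x0 :: 'a
  assumes "preordered_quasi_metric_space X d le"
    and "seq_increasingly_right_K_complete X d le"
    and "\<And>s x. \<lbrakk>range s \<subseteq> X; x \<in> X; \<forall>n. le (s n) (s (Suc n)); qm_converges X d s x\<rbrakk>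
           \<Longrightarrow> \<forall>n. le (s n) x"
    and "\<forall>x\<in>X. \<phi> x \<noteq> -\<infinity>"
    and "proper_fun X \<phi>"
    and "bounded_below_fun X \<phi>"
    and "increasingly_lsc X d le \<phi>"
    and "\<epsilon> > 0" and "lam > 0"
    and "x0 \<in> X"
    and "\<phi> x0 \<le> ereal \<epsilon> + (INF x\<in>X. \<phi> x)"
  shows "\<exists>z\<in>eff_dom X \<phi>.
      (\<phi> z + ereal (\<epsilon> / lam * d z x0) \<le> \<phi> x0 \<and> \<phi> z \<le> \<phi> x0)
    \<and> d z x0 \<le> lam
    \<and> (\<forall>y\<in>S_set X d le \<phi> \<epsilon> lam z. \<phi> y = \<phi> z)
    \<and> (\<forall>x\<in>eff_dom X \<phi> - S_set X d le \<phi> \<epsilon> lam z. le z x \<longrightarrow>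
          \<phi> z < \<phi> x + ereal (\<epsilon> / lam * d x z))
    \<and> (\<forall>x\<in>X - eff_dom X \<phi>. \<phi> z < \<phi> x + ereal (\<epsilon> / lam * d x z))"
proof -
  interpret preordered_quasi_metric_space X d le by fact
  have \<gamma>: "\<epsilon> / lam > 0" using assms(8,9) by simp
  have \<phi>_x0_le: "\<phi> x0 \<le> ereal \<epsilon> + \<phi> y" if "y \<in> X" for y
    using assms(11) INF_lower[OF that, of \<phi>] by (meson add_left_mono order_trans)
  obtain p where "p \<in> X" "\<phi> p < \<infinity>" using assms(5) by (auto simp: proper_fun_def eff_dom_def)
  \<comment> \<open>Comparison with one point \<open>p\<close> of finite value suffices.\<close>
  then have "\<phi> x0 < \<infinity>" using \<phi>_x0_le[of p] by (cases "\<phi> p") auto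
  then have x0: "x0 \<in> eff_dom X \<phi>" using assms(10) by (simp add: eff_dom_def)
  obtain z where z: "z \<in> S_set X d le \<phi> \<epsilon> lam x0"
    and z_min: "\<forall>y\<in>S_set X d le \<phi> \<epsilon> lam z. \<phi> y = \<phi> z"
    using ex_minimal_in_S_set[OF assms(2,3,4,6,7) \<gamma> x0] by blast
  have zD: "z \<in> eff_dom X \<phi>" using z S_set_iff_real[OF x0 assms(4)] by blast
  then have zX: "z \<in> X" by (simp add: eff_dom_def)
  obtain r where r: "\<phi> z = ereal r" using eff_domD(2)[OF zD assms(4)] by blast
  obtain r0 where r0: "\<phi> x0 = ereal r0" using eff_domD(2)[OF x0 assms(4)] by blast
  have i: "\<phi> z + ereal (\<epsilon> / lam * d z x0) \<le> \<phi> x0" using z by (simp add: S_set_def)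
  have "0 \<le> \<epsilon> / lam * d z x0"
    using \<gamma> nonneg[OF zX assms(10)] by (intro mult_nonneg_nonneg) auto
  then have le_x0: "\<phi> z \<le> \<phi> x0" using i r r0 by simp
  \<comment> \<open>By (i) the left side is at most \<open>\<phi> x0 - \<phi> z\<close>, which is at
    most \<epsilon> by the near-minimality of \<open>x0\<close> tested at \<open>z\<close>.\<close>
  have "\<epsilon> / lam * d z x0 \<le> \<epsilon>" using \<phi>_x0_le[OF zX] i r r0 by simp
  then have ii: "d z x0 \<le> lam" using assms(8,9) by (simp add: field_simps)
  \<comment> \<open>Given \<open>le z x\<close>, only the inequality in \<open>S_set\<close> can
    fail, and its negation is the claim. Outside the effective domain the right side is
    \<infinity>.\<close>
  have iv: "\<phi> z < \<phi> x + ereal (\<epsilon> / lam * d x z)"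
    if "x \<in> eff_dom X \<phi> - S_set X d le \<phi> \<epsilon> lam z" "le z x" for x
    using that by (auto simp: S_set_def eff_dom_def)
  have "\<phi> z < \<phi> x + ereal (\<epsilon> / lam * d x z)" if "x \<in> X - eff_dom X \<phi>" for x
    using that r by (simp add: eff_dom_def)
  with zD i le_x0 ii z_min iv show ?thesis by blast
qed

end
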